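(* Let $\Delta^{(0)},\Delta^{(1)}$ be dynamic theories, $\mathcal A^c$ a set of heterogeneous atoms over them, $\Delta^{sh}$ the resulting simple heterogeneous dynamic theory, and $\Delta^{hero}=((\Delta^{sh})^h)^r$ the fully heterogeneous dynamic theory (regular closure of the havoc lift of $\Delta^{sh}$). Then $\Delta^{hero}$ is a dynamic theory, and: (i) for all programs $\alpha,\beta$ of $\Delta^{hero}$, first-order $\phi$ and formulas $\psi,\chi$, the formulas $[?(\phi)]\psi\leftrightarrow(\phi\to\psi)$, $[\alpha;\beta]\chi\leftrightarrow[\alpha][\beta]\chi$, $[\alpha^*]\chi\leftrightarrow\chi\wedge[\alpha][\alpha^*]\chi$, $[\alpha\cup\beta]\chi\leftrightarrow[\alpha]\chi\wedge[\beta]\chi$, and $[\alpha^*](\chi\to[\alpha]\chi)\to(\chi\to[\alpha^*]\chi)$ are $\Delta^{hero}$-valid; (ii) $([v:=*]\phi)\leftrightarrow\forall v\,\phi$ is $\Delta^{hero}$-valid for every variable $v$ and formula $\phi$; (iii) every $\Delta^{sh}$-valid formula over the signature of $\Delta^{sh}$ is $(\Delta^{sh})^h$-valid, and every $(\Delta^{sh})^h$-valid formula over the signature of $(\Delta^{sh})^h$ is $\Delta^{hero}$-valid.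
   Context: A dynamic theory $\Delta$ consists of: pairwise disjoint sets $\mathcal V,\mathcal A,\mathcal P$ (variables, atoms, programs); a nonempty set $U$; a nonempty set $S$ of states with $\mathrm{val}:S\times\mathcal V\to U$ satisfying interpolation (for all $\mu,\nu\in S$, $W\subseteq\mathcal V$ there is $\omega$ agreeing with $\mu$ on $W$ and with $\nu$ outside $W$); $\mathcal E_A:\mathcal A\to2^S$, $\mathrm{FV}_A$ with finite values and states agreeing on $\mathrm{FV}_A(a)$ both in or both out of $\mathcal E_A(a)$; $\mathcal E_P:\mathcal P\to2^{S\times S}$, $\mathrm{FV}_P$ with finite values, overapproximation (for $W\supseteq\mathrm{FV}_P(p)$, $\mu=_W\nu$, $(\mu,\omega)\in\mathcal E_P(p)$ there is $\tilde\omega$ with $(\nu,\tilde\omega)\in\mathcal E_P(p)$, $\omega=_W\tilde\omega$) and extensionality (if $\mu=_{\mathcal V}\nu$ then $(\mu,\omega)\in\mathcal E_P(p)\iff(\nu,\omega)\in\mathcal E_P(p)$); $\mu=_W\nu$ means equal values on all $v\in W$. Formulas $a\mid\neg F\mid F\wedge G\mid\forall vF\mid[p]F$ with standard semantics ($[\![\forall vF]\!]$: all $\nu=_{\mathcal V\setminus\{v\}}\mu$ satisfy $F$; $[\![[p]F]\!]$: all $\mathcal E_P(p)$-successors satisfy $F$); valid = true in all states; first-order = no boxes. Havoc lift $\Delta^h$: add programs $v:=*$ ($v\in\mathcal V$) with $\mathcal E(v:=* )=\{(\mu,\nu):\mu=_{\mathcal V\setminus\{v\}}\nu\}$, $\mathrm{FV}_P(v:=*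 )=\emptyset$. Regular closure $\Delta^r$: programs $r\mid p;q\mid p\cup q\mid?(\phi)\mid p^*$ ($r$ an original program, $\phi$ first-order) with composition, union, $\mathcal E(?(\phi))=\{(\mu,\nu):\mu\in[\![\phi]\!],\mu=_{\mathcal V}\nu\}$, $\mathcal E(p^* )=\bigcup_n\mathcal E(p^n)$; $\mathrm{FV}_P$ of composites is the union of components' ($\mathrm{FV}_P(?(\phi))$ the syntactic free variables of $\phi$, defined from $\mathrm{FV}_A$). Simple heterogeneous theory $\Delta^{sh}$ over $\Delta^{(0)},\Delta^{(1)}$ and heterogeneous atoms $\mathcal A^c$ (atoms with evaluation $\mathcal E^c_A:\mathcal A^c\to2^{S^{(0)}\times S^{(1)}}$ and free variables in $\mathcal V^{(0)}\cup\mathcal V^{(1)}$ satisfying the atom requirements): variables $\mathcal V^{(0)}\dot\cup\mathcal V^{(1)}$, atoms $\mathcal A^{(0)}\dot\cup\mathcal A^{(1)}\dot\cup\mathcal A^c$, programs $\mathcal P^{(0)}\dot\cup\mathcal P^{(1)}$, universe $U^{(0)}\cup U^{(1)}$, states $S^{(0)}\times S^{(1)}$ with $\mathrm{val}((\mu_0,\mu_1),v)=\mathrm{val}^{(i)}(\mu_i,v)$ for $v\in\mathcal V^{(i)}$; atoms of $\mathcal A^{(0)}$ evaluate to $\mathcal E^{(0)}_A(a)\times S^{(1)}$, of $\mathcal A^{(1)}$ to $S^{(0)}\times\mathcal E^{(1)}_A(a)$, heterogeneous atoms by $\mathcal E^c_A$; programs $p\in\mathcal P^{(i)}$ are evaluated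 by $\mathcal E^{(i)}_P$ on the $i$-th component, other component unchanged, with $\mathrm{FV}_P=\mathrm{FV}^{(i)}_P$.
   Formalization: In the simple heterogeneous theory, "other component unchanged" is read as all its variables keeping their values (not identical states), and p^0 as the true test relating states with equal values; with literal identity, extensionality can fail. *)

theory Defs
  imports Main
begin

section \<open>Formulas and dynamic theories\<close>

datatype (fml_vars: 'v, fml_atoms: 'a, fml_progs: 'p) fml =
    Atom 'a
  | Neg "('v, 'a, 'p) fml"
  | And "('v, 'a, 'p) fml" "('v, 'a, 'p) fml"
  | All 'v "('v, 'a, 'p) fml"
  | Box 'p "('v, 'a, 'p) fml"
  for map: map_fml

abbreviation Imp :: "('v, 'a, 'p) fml \<Rightarrow> ('v, 'a, 'p) fml \<Rightarrow> ('v, 'a, 'p) fml" where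
  "Imp F G \<equiv> Neg (And F (Neg G))"

abbreviation Iff :: "('v, 'a, 'p) fml \<Rightarrow> ('v, 'a, 'p) fml \<Rightarrow> ('v, 'a, 'p) fml" where
  "Iff F G \<equiv> And (Imp F G) (Imp G F)"

primrec first_order :: "('v, 'a, 'p) fml \<Rightarrow> bool" where
  "first_order (Atom a) = True"
| "first_order (Neg F) = first_order F"
| "first_order (And F G) = (first_order F \<and> first_order G)"
| "first_order (All v F) = first_order F"
| "first_order (Box p F) = False"

text \<open>Variables, atoms and programs are carrier sets (possibly empty) in three different types,
  so their pairwise disjointness is automatic.\<close>

record ('v, 'a, 'p, 'u, 's) dyn_theory =
  vars :: "'v set"
  atoms :: "'a set"
  progs :: "'p set"
  univ :: "'u set"
  states :: "'s set"
  val :: "'s \<Rightarrow> 'v \<Rightarrow> 'u"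
  evalA :: "'a \<Rightarrow> 's set"
  fvA :: "'a \<Rightarrow> 'v set"
  evalP :: "'p \<Rightarrow> ('s \<times> 's) set"
  fvP :: "'p \<Rightarrow> 'v set"

definition agree :: "('v, 'a, 'p, 'u, 's) dyn_theory \<Rightarrow> 'v set \<Rightarrow> 's \<Rightarrow> 's \<Rightarrow> bool" where
  "agree D W \<mu> \<nu> \<longleftrightarrow> (\<forall>v\<in>W. val D \<mu> v = val D \<nu> v)"

locale dynamic_theory =
  fixes D :: "('v, 'a, 'p, 'u, 's) dyn_theory"
  assumes univ_nonempty: "univ D \<noteq> {}"
    and states_nonempty: "states D \<noteq> {}"
    and val_in_univ: "\<mu> \<in> states D \<Longrightarrow> v \<in> vars D \<Longrightarrow> val D \<mu> v \<in> univ D"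
    and interpolation:
      "\<mu> \<in> states D \<Longrightarrow> \<nu> \<in> states D \<Longrightarrow> W \<subseteq> vars D \<Longrightarrow>
        \<exists>\<omega>\<in>states D. agree D W \<omega> \<mu> \<and> agree D (vars D - W) \<omega> \<nu>"
    and evalA_states: "a \<in> atoms D \<Longrightarrow> evalA D a \<subseteq> states D"
    and fvA_vars: "a \<in> atoms D \<Longrightarrow> fvA D a \<subseteq> vars D"
    and fvA_finite: "a \<in> atoms D \<Longrightarrow> finite (fvA D a)"
    and evalA_agree:
      "a \<in> atoms D \<Longrightarrow> \<mu> \<in> states D \<Longrightarrow> \<nu> \<in> states D \<Longrightarrow> agree D (fvA D a) \<mu> \<nu> \<Longrightarrow>
        \<mu> \<in> evalA D a \<longleftrightarrow> \<nu> \<in> evalA D a"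
    and evalP_states: "p \<in> progs D \<Longrightarrow> evalP D p \<subseteq> states D \<times> states D"
    and fvP_vars: "p \<in> progs D \<Longrightarrow> fvP D p \<subseteq> vars D"
    and fvP_finite: "p \<in> progs D \<Longrightarrow> finite (fvP D p)"
    and overapproximation:
      "p \<in> progs D \<Longrightarrow> fvP D p \<subseteq> W \<Longrightarrow> W \<subseteq> vars D \<Longrightarrow>
        \<mu> \<in> states D \<Longrightarrow> \<nu> \<in> states D \<Longrightarrow> \<omega> \<in> states D \<Longrightarrow>
        agree D W \<mu> \<nu> \<Longrightarrow> (\<mu>, \<omega>) \<in> evalP D p \<Longrightarrow>
        \<exists>\<omega>'\<in>states D. (\<nu>, \<omega>') \<in> evalP D p \<and> agree D W \<omega> \<omega>'"
    and extensionality: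
      "p \<in> progs D \<Longrightarrow> \<mu> \<in> states D \<Longrightarrow> \<nu> \<in> states D \<Longrightarrow> \<omega> \<in> states D \<Longrightarrow>
        agree D (vars D) \<mu> \<nu> \<Longrightarrow> (\<mu>, \<omega>) \<in> evalP D p \<longleftrightarrow> (\<nu>, \<omega>) \<in> evalP D p"

definition formulas :: "('v, 'a, 'p, 'u, 's) dyn_theory \<Rightarrow> ('v, 'a, 'p) fml set" where
  "formulas D = {F. fml_vars F \<subseteq> vars D \<and> fml_atoms F \<subseteq> atoms D \<and> fml_progs F \<subseteq> progs D}"

primrec sem :: "('v, 'a, 'p, 'u, 's) dyn_theory \<Rightarrow> ('v, 'a, 'p) fml \<Rightarrow> 's set" where
  "sem D (Atom a) = evalA D a"
| "sem D (Neg F) = states D - sem D F"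
| "sem D (And F G) = sem D F \<inter> sem D G"
| "sem D (All v F) =
    {\<mu> \<in> states D. \<forall>\<nu>\<in>states D. agree D (vars D - {v}) \<nu> \<mu> \<longrightarrow> \<nu> \<in> sem D F}"
| "sem D (Box p F) = {\<mu> \<in> states D. \<forall>\<nu>. (\<mu>, \<nu>) \<in> evalP D p \<longrightarrow> \<nu> \<in> sem D F}"

definition valid :: "('v, 'a, 'p, 'u, 's) dyn_theory \<Rightarrow> ('v, 'a, 'p) fml \<Rightarrow> bool" where
  "valid D F \<longleftrightarrow> (\<forall>\<mu>\<in>states D. \<mu> \<in> sem D F)"

text \<open>Syntactic free variables. They are used for first-order formulas only, so the clause for
  boxes plays no role below.\<close>

primrec fvF :: "('v, 'a, 'p, 'u, 's) dyn_theory \<Rightarrow> ('v, 'a, 'p) fml \<Rightarrow> 'v set" where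
  "fvF D (Atom a) = fvA D a"
| "fvF D (Neg F) = fvF D F"
| "fvF D (And F G) = fvF D F \<union> fvF D G"
| "fvF D (All v F) = fvF D F - {v}"
| "fvF D (Box p F) = fvP D p \<union> fvF D F"


section \<open>Havoc lift\<close>

datatype ('v, 'p) hprog = Orig 'p | Havoc 'v

definition havoc_lift ::
    "('v, 'a, 'p, 'u, 's) dyn_theory \<Rightarrow> ('v, 'a, ('v, 'p) hprog, 'u, 's) dyn_theory" where
  "havoc_lift D = \<lparr>
     vars = vars D, atoms = atoms D,
     progs = Orig ` progs D \<union> Havoc ` vars D,
     univ = univ D, states = states D, val = val D, evalA = evalA D, fvA = fvA D,
     evalP = (\<lambda>q. case q of
         Orig p \<Rightarrow> evalP D p
       | Havoc v \<Rightarrow> {(\<mu>, \<nu>) \<in> states D \<times> states D. agree D (vars D - {v}) \<mu> \<nu>}),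
     fvP = (\<lambda>q. case q of Orig p \<Rightarrow> fvP D p | Havoc v \<Rightarrow> {}) \<rparr>"

abbreviation havoc_emb :: "('v, 'a, 'p) fml \<Rightarrow> ('v, 'a, ('v, 'p) hprog) fml" where
  "havoc_emb \<equiv> map_fml id id Orig"


section \<open>Regular closure\<close>

text \<open>A test carries a formula of the original theory, which \<open>reg_progs\<close> requires to be
  first-order. As it has no boxes, it is via \<open>reg_emb\<close> below the same thing as a first-order
  formula of the closure.\<close>

datatype ('v, 'a, 'p) rprog =
    Base 'p
  | Seq "('v, 'a, 'p) rprog" "('v, 'a, 'p) rprog"
  | Choice "('v, 'a, 'p) rprog" "('v, 'a, 'p) rprog"
  | Test "('v, 'a, 'p) fml"
  | Star "('v, 'a, 'p) rprog"

inductive_set reg_progs :: "('v, 'a, 'p, 'u, 's) dyn_theory \<Rightarrow> ('v, 'a, 'p) rprog set"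
  for D :: "('v, 'a, 'p, 'u, 's) dyn_theory" where
  "p \<in> progs D \<Longrightarrow> Base p \<in> reg_progs D"
| "\<alpha> \<in> reg_progs D \<Longrightarrow> \<beta> \<in> reg_progs D \<Longrightarrow> Seq \<alpha> \<beta> \<in> reg_progs D"
| "\<alpha> \<in> reg_progs D \<Longrightarrow> \<beta> \<in> reg_progs D \<Longrightarrow> Choice \<alpha> \<beta> \<in> reg_progs D"
| "\<phi> \<in> formulas D \<Longrightarrow> first_order \<phi> \<Longrightarrow> Test \<phi> \<in> reg_progs D"
| "\<alpha> \<in> reg_progs D \<Longrightarrow> Star \<alpha> \<in> reg_progs D"

text \<open>The evaluation of the \<open>n\<close>-th power of a program with evaluation \<open>R\<close>. The zeroth power is the
  trivially true test, which relates states with equal values (not only identical states); with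
  the identity relation instead, extensionality would fail for iterations.\<close>

primrec iterate ::
    "('v, 'a, 'p, 'u, 's) dyn_theory \<Rightarrow> ('s \<times> 's) set \<Rightarrow> nat \<Rightarrow> ('s \<times> 's) set" where
  "iterate D R 0 = {(\<mu>, \<nu>) \<in> states D \<times> states D. agree D (vars D) \<mu> \<nu>}"
| "iterate D R (Suc n) = R O iterate D R n"

primrec reg_evalP ::
    "('v, 'a, 'p, 'u, 's) dyn_theory \<Rightarrow> ('v, 'a, 'p) rprog \<Rightarrow> ('s \<times> 's) set" where
  "reg_evalP D (Base p) = evalP D p"
| "reg_evalP D (Seq \<alpha> \<beta>) = reg_evalP D \<alpha> O reg_evalP D \<beta>"
| "reg_evalP D (Choice \<alpha> \<beta>) = reg_evalP D \<alpha> \<union> reg_evalP D \<beta>"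
| "reg_evalP D (Test \<phi>) =
    {(\<mu>, \<nu>) \<in> states D \<times> states D. \<mu> \<in> sem D \<phi> \<and> agree D (vars D) \<mu> \<nu>}"
| "reg_evalP D (Star \<alpha>) = (\<Union>n. iterate D (reg_evalP D \<alpha>) n)"

primrec reg_fvP :: "('v, 'a, 'p, 'u, 's) dyn_theory \<Rightarrow> ('v, 'a, 'p) rprog \<Rightarrow> 'v set" where
  "reg_fvP D (Base p) = fvP D p"
| "reg_fvP D (Seq \<alpha> \<beta>) = reg_fvP D \<alpha> \<union> reg_fvP D \<beta>"
| "reg_fvP D (Choice \<alpha> \<beta>) = reg_fvP D \<alpha> \<union> reg_fvP D \<beta>"
| "reg_fvP D (Test \<phi>) = fvF D \<phi>"
| "reg_fvP D (Star \<alpha>) = reg_fvP D \<alpha>"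

definition regular_closure ::
    "('v, 'a, 'p, 'u, 's) dyn_theory \<Rightarrow> ('v, 'a, ('v, 'a, 'p) rprog, 'u, 's) dyn_theory" where
  "regular_closure D = \<lparr>
     vars = vars D, atoms = atoms D, progs = reg_progs D,
     univ = univ D, states = states D, val = val D, evalA = evalA D, fvA = fvA D,
     evalP = reg_evalP D, fvP = reg_fvP D \<rparr>"

abbreviation reg_emb :: "('v, 'a, 'p) fml \<Rightarrow> ('v, 'a, ('v, 'a, 'p) rprog) fml" where
  "reg_emb \<equiv> map_fml id id Base"


section \<open>Heterogeneous dynamic theories\<close>

text \<open>The two universes share one type, because the heterogeneous universe is their plain,
  not necessarily disjoint, union.\<close>

primrec het_val ::
    "('v0, 'a0, 'p0, 'u, 's0) dyn_theory \<Rightarrow> ('v1, 'a1, 'p1, 'u, 's1) dyn_theory \<Rightarrow>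
      's0 \<times> 's1 \<Rightarrow> 'v0 + 'v1 \<Rightarrow> 'u" where
  "het_val D0 D1 \<mu> (Inl v) = val D0 (fst \<mu>) v"
| "het_val D0 D1 \<mu> (Inr v) = val D1 (snd \<mu>) v"

record ('c, 'v0, 'v1, 's0, 's1) het_atoms =
  hatoms :: "'c set"
  hevalA :: "'c \<Rightarrow> ('s0 \<times> 's1) set"
  hfvA :: "'c \<Rightarrow> ('v0 + 'v1) set"

locale heterogeneous_atoms =
  fixes D0 :: "('v0, 'a0, 'p0, 'u, 's0) dyn_theory"
    and D1 :: "('v1, 'a1, 'p1, 'u, 's1) dyn_theory"
    and H :: "('c, 'v0, 'v1, 's0, 's1) het_atoms"
  assumes hevalA_states: "c \<in> hatoms H \<Longrightarrow> hevalA H c \<subseteq> states D0 \<times> states D1"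
    and hfvA_vars: "c \<in> hatoms H \<Longrightarrow> hfvA H c \<subseteq> vars D0 <+> vars D1"
    and hfvA_finite: "c \<in> hatoms H \<Longrightarrow> finite (hfvA H c)"
    and hevalA_agree:
      "c \<in> hatoms H \<Longrightarrow> \<mu> \<in> states D0 \<times> states D1 \<Longrightarrow> \<nu> \<in> states D0 \<times> states D1 \<Longrightarrow>
        \<forall>v\<in>hfvA H c. het_val D0 D1 \<mu> v = het_val D0 D1 \<nu> v \<Longrightarrow>
        \<mu> \<in> hevalA H c \<longleftrightarrow> \<nu> \<in> hevalA H c"

text \<open>That a program of one theory leaves the component of the other theory unchanged means, as
  for tests, that all its variables keep their values. If two states of a component theory may
  have the same values, demanding identical components would violate extensionality.\<close>

definition simple_het ::
    "('v0, 'a0, 'p0, 'u, 's0) dyn_theory \<Rightarrow> ('v1, 'a1, 'p1, 'u, 's1) dyn_theory \<Rightarrow>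
      ('c, 'v0, 'v1, 's0, 's1) het_atoms \<Rightarrow>
      ('v0 + 'v1, 'a0 + 'a1 + 'c, 'p0 + 'p1, 'u, 's0 \<times> 's1) dyn_theory" where
  "simple_het D0 D1 H = \<lparr>
     vars = vars D0 <+> vars D1,
     atoms = atoms D0 <+> (atoms D1 <+> hatoms H),
     progs = progs D0 <+> progs D1,
     univ = univ D0 \<union> univ D1,
     states = states D0 \<times> states D1,
     val = het_val D0 D1,
     evalA = (\<lambda>a. case a of
         Inl a0 \<Rightarrow> evalA D0 a0 \<times> states D1
       | Inr (Inl a1) \<Rightarrow> states D0 \<times> evalA D1 a1
       | Inr (Inr c) \<Rightarrow> hevalA H c),
     fvA = (\<lambda>a. case a of
         Inl a0 \<Rightarrow> Inl ` fvA D0 a0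
       | Inr (Inl a1) \<Rightarrow> Inr ` fvA D1 a1
       | Inr (Inr c) \<Rightarrow> hfvA H c),
     evalP = (\<lambda>p. case p of
         Inl p0 \<Rightarrow> {((\<mu>0, \<mu>1), (\<nu>0, \<nu>1)). (\<mu>0, \<nu>0) \<in> evalP D0 p0 \<and>
                     \<mu>1 \<in> states D1 \<and> \<nu>1 \<in> states D1 \<and> agree D1 (vars D1) \<mu>1 \<nu>1}
       | Inr p1 \<Rightarrow> {((\<mu>0, \<mu>1), (\<nu>0, \<nu>1)). (\<mu>1, \<nu>1) \<in> evalP D1 p1 \<and>
                     \<mu>0 \<in> states D0 \<and> \<nu>0 \<in> states D0 \<and> agree D0 (vars D0) \<mu>0 \<nu>0}),
     fvP = (\<lambda>p. case p of Inl p0 \<Rightarrow> Inl ` fvP D0 p0 | Inr p1 \<Rightarrow> Inr ` fvP D1 p1) \<rparr>"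

definition full_het ::
    "('v0, 'a0, 'p0, 'u, 's0) dyn_theory \<Rightarrow> ('v1, 'a1, 'p1, 'u, 's1) dyn_theory \<Rightarrow>
      ('c, 'v0, 'v1, 's0, 's1) het_atoms \<Rightarrow>
      ('v0 + 'v1, 'a0 + 'a1 + 'c,
       ('v0 + 'v1, 'a0 + 'a1 + 'c, ('v0 + 'v1, 'p0 + 'p1) hprog) rprog, 'u, 's0 \<times> 's1)
      dyn_theory" where
  "full_het D0 D1 H = regular_closure (havoc_lift (simple_het D0 D1 H))"

end

(* The only points where values rather than states matter are tests and empty iterations, which
   relate all states with equal values. They are handled by the coincidence property: the truth of
   a formula depends only on the values of the state (by extensionality), and that of a first-order
   formula only on the values of its free variables (by interpolation). *)
theory Submission
  imports Defs
begin

section \<open>Agreement of states, and the components of the three constructions\<close>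

lemma agree_refl: "agree D W \<mu> \<mu>"
  by (simp add: agree_def)

lemma agree_sym: "agree D W \<mu> \<nu> \<Longrightarrow> agree D W \<nu> \<mu>"
  by (simp add: agree_def)

lemma agree_commute: "agree D W \<mu> \<nu> \<longleftrightarrow> agree D W \<nu> \<mu>"
  by (auto simp: agree_def)

lemma agree_trans: "agree D W \<mu> \<nu> \<Longrightarrow> agree D W \<nu> \<omega> \<Longrightarrow> agree D W \<mu> \<omega>"
  by (simp add: agree_def)

lemma agree_mono: "agree D W \<mu> \<nu> \<Longrightarrow> W' \<subseteq> W \<Longrightarrow> agree D W' \<mu> \<nu>"
  by (auto simp: agree_def)

lemma formulas_simps [simp]:
  "Atom a \<in> formulas D \<longleftrightarrow> a \<in> atoms D"
  "Neg F \<in> formulas D \<longleftrightarrow> F \<in> formulas D"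
  "And F G \<in> formulas D \<longleftrightarrow> F \<in> formulas D \<and> G \<in> formulas D"
  "All v F \<in> formulas D \<longleftrightarrow> v \<in> vars D \<and> F \<in> formulas D"
  "Box p F \<in> formulas D \<longleftrightarrow> p \<in> progs D \<and> F \<in> formulas D"
  by (auto simp: formulas_def)

lemma havoc_lift_simps [simp]:
  "vars (havoc_lift D) = vars D"
  "atoms (havoc_lift D) = atoms D"
  "progs (havoc_lift D) = Orig ` progs D \<union> Havoc ` vars D"
  "univ (havoc_lift D) = univ D"
  "states (havoc_lift D) = states D"
  "val (havoc_lift D) = val D"
  "evalA (havoc_lift D) = evalA D"
  "fvA (havoc_lift D) = fvA D"
  "evalP (havoc_lift D) (Orig p) = evalP D p"
  "evalP (havoc_lift D) (Havoc v) =
    {(\<mu>, \<nu>) \<in> states D \<times> states D. agree D (vars D - {v}) \<mu> \<nu>}"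
  "fvP (havoc_lift D) (Orig p) = fvP D p"
  "fvP (havoc_lift D) (Havoc v) = {}"
  "agree (havoc_lift D) = agree D"
  by (simp_all add: havoc_lift_def agree_def fun_eq_iff)

lemma regular_closure_simps [simp]:
  "vars (regular_closure D) = vars D"
  "atoms (regular_closure D) = atoms D"
  "progs (regular_closure D) = reg_progs D"
  "univ (regular_closure D) = univ D"
  "states (regular_closure D) = states D"
  "val (regular_closure D) = val D"
  "evalA (regular_closure D) = evalA D"
  "fvA (regular_closure D) = fvA D"
  "evalP (regular_closure D) = reg_evalP D"
  "fvP (regular_closure D) = reg_fvP D"
  "agree (regular_closure D) = agree D"
  by (simp_all add: regular_closure_def agree_def fun_eq_iff)

lemma simple_het_simps [simp]:
  "vars (simple_het D0 D1 H) = vars D0 <+> vars D1"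
  "atoms (simple_het D0 D1 H) = atoms D0 <+> (atoms D1 <+> hatoms H)"
  "progs (simple_het D0 D1 H) = progs D0 <+> progs D1"
  "univ (simple_het D0 D1 H) = univ D0 \<union> univ D1"
  "states (simple_het D0 D1 H) = states D0 \<times> states D1"
  "val (simple_het D0 D1 H) = het_val D0 D1"
  "evalA (simple_het D0 D1 H) (Inl a0) = evalA D0 a0 \<times> states D1"
  "evalA (simple_het D0 D1 H) (Inr (Inl a1)) = states D0 \<times> evalA D1 a1"
  "evalA (simple_het D0 D1 H) (Inr (Inr c)) = hevalA H c"
  "fvA (simple_het D0 D1 H) (Inl a0) = Inl ` fvA D0 a0"
  "fvA (simple_het D0 D1 H) (Inr (Inl a1)) = Inr ` fvA D1 a1"
  "fvA (simple_het D0 D1 H) (Inr (Inr c)) = hfvA H c"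
  "evalP (simple_het D0 D1 H) (Inl p0) =
    {((\<mu>0, \<mu>1), (\<nu>0, \<nu>1)). (\<mu>0, \<nu>0) \<in> evalP D0 p0 \<and>
      \<mu>1 \<in> states D1 \<and> \<nu>1 \<in> states D1 \<and> agree D1 (vars D1) \<mu>1 \<nu>1}"
  "evalP (simple_het D0 D1 H) (Inr p1) =
    {((\<mu>0, \<mu>1), (\<nu>0, \<nu>1)). (\<mu>1, \<nu>1) \<in> evalP D1 p1 \<and>
      \<mu>0 \<in> states D0 \<and> \<nu>0 \<in> states D0 \<and> agree D0 (vars D0) \<mu>0 \<nu>0}"
  "fvP (simple_het D0 D1 H) (Inl p0) = Inl ` fvP D0 p0"
  "fvP (simple_het D0 D1 H) (Inr p1) = Inr ` fvP D1 p1"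
  by (simp_all add: simple_het_def)

section \<open>Simple heterogeneous theories\<close>

text \<open>Each variable belongs to exactly one summand, so preimages under \<open>Inl\<close> and
  \<open>Inr\<close> split a set of variables. This reduces every axiom of the product theory to the
  same axiom of a component theory.\<close>

lemma agree_simple_het:
  "agree (simple_het D0 D1 H) W \<mu> \<nu> \<longleftrightarrow>
    agree D0 (Inl -` W) (fst \<mu>) (fst \<nu>) \<and> agree D1 (Inr -` W) (snd \<mu>) (snd \<nu>)"
proof
  assume "agree (simple_het D0 D1 H) W \<mu> \<nu>"
  then have *: "het_val D0 D1 \<mu> v = het_val D0 D1 \<nu> v" if "v \<in> W" for v
    using that by (simp add: agree_def)
  show "agree D0 (Inl -` W) (fst \<mu>) (fst \<nu>) \<and> agree D1 (Inr -` W) (snd \<mu>) (snd \<nu>)"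
    using *[of "Inl _"] *[of "Inr _"] by (simp add: agree_def)
next
  assume *: "agree D0 (Inl -` W) (fst \<mu>) (fst \<nu>) \<and> agree D1 (Inr -` W) (snd \<mu>) (snd \<nu>)"
  have "het_val D0 D1 \<mu> v = het_val D0 D1 \<nu> v" if "v \<in> W" for v
    using that * by (cases v) (auto simp: agree_def)
  then show "agree (simple_het D0 D1 H) W \<mu> \<nu>" by (simp add: agree_def)
qed

lemma dynamic_theory_simple_het:
  assumes "dynamic_theory D0" and "dynamic_theory D1" and "heterogeneous_atoms D0 D1 H"
  shows "dynamic_theory (simple_het D0 D1 H)"
proof -
  interpret D0: dynamic_theory D0 by fact
  interpret D1: dynamic_theory D1 by fact
  interpret H: heterogeneous_atoms D0 D1 H by fact
  let ?D = "simple_het D0 D1 H"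
  have vimage_Inl_image: "Inl -` (Inl ` A) = A" "Inr -` (Inl ` A) = {}"
    and vimage_Inr_image: "Inr -` (Inr ` B) = B" "Inl -` (Inr ` B) = {}"
    for A :: "'x set" and B :: "'y set"
    by auto
  have vimage_Plus: "Inl -` (A <+> B) = A" "Inr -` (A <+> B) = B"
    for A :: "'x set" and B :: "'y set"
    by auto
  show ?thesis
  proof
    show "univ ?D \<noteq> {}" using D0.univ_nonempty by simp
    show "states ?D \<noteq> {}" using D0.states_nonempty D1.states_nonempty by auto
  next
    fix \<mu> v assume "\<mu> \<in> states ?D" "v \<in> vars ?D"
    then show "val ?D \<mu> v \<in> univ ?D"
      using D0.val_in_univ D1.val_in_univ by (cases v) auto
  next
    fix \<mu> \<nu> W assume \<mu>: "\<mu> \<in> states ?D" and \<nu>: "\<nu> \<in> states ?D" and W: "W \<subseteq> vars ?D"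
    have "Inl -` W \<subseteq> vars D0" "Inr -` W \<subseteq> vars D1" using W by auto
    with \<mu> \<nu> D0.interpolation[of "fst \<mu>" "fst \<nu>" "Inl -` W"]
      D1.interpolation[of "snd \<mu>" "snd \<nu>" "Inr -` W"]
    obtain \<omega>0 \<omega>1 where
      "\<omega>0 \<in> states D0" "agree D0 (Inl -` W) \<omega>0 (fst \<mu>)"
      "agree D0 (vars D0 - Inl -` W) \<omega>0 (fst \<nu>)"
      "\<omega>1 \<in> states D1" "agree D1 (Inr -` W) \<omega>1 (snd \<mu>)"
      "agree D1 (vars D1 - Inr -` W) \<omega>1 (snd \<nu>)"
      by auto
    \<comment> \<open>Interpolation is done separately in each component, and the two results are
      paired.\<close>
    then show "\<exists>\<omega>\<in>states ?D. agree ?D W \<omega> \<mu> \<and> agree ?D (vars ?D - W) \<omega> \<nu>"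
      by (intro bexI[of _ "(\<omega>0, \<omega>1)"])
        (auto simp: agree_simple_het vimage_Diff vimage_Plus)
  next
    fix a assume a: "a \<in> atoms ?D"
    then consider (0) a0 where "a = Inl a0" "a0 \<in> atoms D0"
      | (1) a1 where "a = Inr (Inl a1)" "a1 \<in> atoms D1"
      | (c) c where "a = Inr (Inr c)" "c \<in> hatoms H"
      by auto
    note cs = this
    show "evalA ?D a \<subseteq> states ?D"
      by (cases rule: cs) (use D0.evalA_states D1.evalA_states H.hevalA_states in auto)
    show "fvA ?D a \<subseteq> vars ?D"
      by (cases rule: cs) (use D0.fvA_vars D1.fvA_vars H.hfvA_vars in auto)
    show "finite (fvA ?D a)"
      by (cases rule: cs) (use D0.fvA_finite D1.fvA_finite H.hfvA_finite in auto)
    fix \<mu> \<nu> assume \<mu>: "\<mu> \<in> states ?D" and \<nu>: "\<nu> \<in> states ?D"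
      and ag: "agree ?D (fvA ?D a) \<mu> \<nu>"
    show "\<mu> \<in> evalA ?D a \<longleftrightarrow> \<nu> \<in> evalA ?D a"
    proof (cases rule: cs)
      case 0
      then have "agree D0 (fvA D0 a0) (fst \<mu>) (fst \<nu>)"
        using ag by (simp add: agree_simple_het vimage_Inl_image)
      then show ?thesis using 0 \<mu> \<nu> D0.evalA_agree[of a0 "fst \<mu>" "fst \<nu>"] by auto
    next
      case 1
      then have "agree D1 (fvA D1 a1) (snd \<mu>) (snd \<nu>)"
        using ag by (simp add: agree_simple_het vimage_Inr_image)
      then show ?thesis using 1 \<mu> \<nu> D1.evalA_agree[of a1 "snd \<mu>" "snd \<nu>"] by auto
    next
      case c
      then show ?thesis using \<mu> \<nu> ag H.hevalA_agree[of c \<mu> \<nu>] by (simp add: agree_def)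
    qed
  next
    fix p assume "p \<in> progs ?D"
    then consider (0) p0 where "p = Inl p0" "p0 \<in> progs D0"
      | (1) p1 where "p = Inr p1" "p1 \<in> progs D1"
      by auto
    note cs = this
    show "evalP ?D p \<subseteq> states ?D \<times> states ?D"
      by (cases rule: cs) (use D0.evalP_states D1.evalP_states in auto)
    show "fvP ?D p \<subseteq> vars ?D"
      by (cases rule: cs) (use D0.fvP_vars D1.fvP_vars in auto)
    show "finite (fvP ?D p)"
      by (cases rule: cs) (use D0.fvP_finite D1.fvP_finite in auto)
    fix \<mu> \<nu> \<omega>
    assume "\<mu> \<in> states ?D" and "\<nu> \<in> states ?D" and "\<omega> \<in> states ?D"
    then obtain \<mu>0 \<mu>1 \<nu>0 \<nu>1 \<omega>0 \<omega>1
      where eq: "\<mu> = (\<mu>0, \<mu>1)" "\<nu> = (\<nu>0, \<nu>1)" "\<omega> = (\<omega>0, \<omega>1)"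
        and st: "\<mu>0 \<in> states D0" "\<nu>0 \<in> states D0" "\<omega>0 \<in> states D0"
          "\<mu>1 \<in> states D1" "\<nu>1 \<in> states D1" "\<omega>1 \<in> states D1"
      by auto
    {
      fix W
      assume fv: "fvP ?D p \<subseteq> W" and W: "W \<subseteq> vars ?D"
        and ag: "agree ?D W \<mu> \<nu>" and run: "(\<mu>, \<omega>) \<in> evalP ?D p"
      have ag0: "agree D0 (Inl -` W) \<mu>0 \<nu>0" and ag1: "agree D1 (Inr -` W) \<mu>1 \<nu>1"
        using ag by (simp_all add: agree_simple_het eq)
      have W0: "Inl -` W \<subseteq> vars D0" and W1: "Inr -` W \<subseteq> vars D1" using W by auto
      show "\<exists>\<omega>'\<in>states ?D. (\<nu>, \<omega>') \<in> evalP ?D p \<and> agree ?D W \<omega> \<omega>'"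
      proof (cases rule: cs)
        case 0
        then have run0: "(\<mu>0, \<omega>0) \<in> evalP D0 p0" and same: "agree D1 (vars D1) \<mu>1 \<omega>1"
          using run by (auto simp: eq)
        have "fvP D0 p0 \<subseteq> Inl -` W" using fv 0 by auto
        then obtain \<omega>0' where "\<omega>0' \<in> states D0" "(\<nu>0, \<omega>0') \<in> evalP D0 p0"
          "agree D0 (Inl -` W) \<omega>0 \<omega>0'"
          using D0.overapproximation[OF 0(2) _ W0 st(1,2,3) ag0 run0] by auto
        \<comment> \<open>The answering run from \<nu> may keep \<nu>1 as its second component. On W
          the values of \<nu>1 are those of \<mu>1, and \<omega>1 has the same values as \<mu>1
          because the program belongs to the other theory.\<close>
        moreover have "agree D1 (Inr -` W) \<omega>1 \<nu>1"
          using ag1 agree_mono[OF same W1] by (blast intro: agree_trans agree_sym)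
        ultimately show ?thesis
          using 0 st by (intro bexI[of _ "(\<omega>0', \<nu>1)"]) (auto simp: eq agree_simple_het agree_refl)
      next
        case 1
        then have run1: "(\<mu>1, \<omega>1) \<in> evalP D1 p1" and same: "agree D0 (vars D0) \<mu>0 \<omega>0"
          using run by (auto simp: eq)
        have "fvP D1 p1 \<subseteq> Inr -` W" using fv 1 by auto
        then obtain \<omega>1' where "\<omega>1' \<in> states D1" "(\<nu>1, \<omega>1') \<in> evalP D1 p1"
          "agree D1 (Inr -` W) \<omega>1 \<omega>1'"
          using D1.overapproximation[OF 1(2) _ W1 st(4,5,6) ag1 run1] by auto
        moreover have "agree D0 (Inl -` W) \<omega>0 \<nu>0"
          using ag0 agree_mono[OF same W0] by (blast intro: agree_trans agree_sym)
        ultimately show ?thesis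
          using 1 st by (intro bexI[of _ "(\<nu>0, \<omega>1')"]) (auto simp: eq agree_simple_het agree_refl)
      qed
    next
      assume "agree ?D (vars ?D) \<mu> \<nu>"
      then have ag0: "agree D0 (vars D0) \<mu>0 \<nu>0" and ag1: "agree D1 (vars D1) \<mu>1 \<nu>1"
        by (simp_all add: agree_simple_het eq vimage_Plus)
      show "(\<mu>, \<omega>) \<in> evalP ?D p \<longleftrightarrow> (\<nu>, \<omega>) \<in> evalP ?D p"
      proof (cases rule: cs)
        case 0
        \<comment> \<open>In the first component this is extensionality of \<open>D0\<close>. In the
          second, having the values of \<mu>1 and having the values of \<nu>1 are the same condition
          on \<omega>1.\<close>
        then show ?thesis
          using st D0.extensionality[OF 0(2) st(1,2,3) ag0] ag1
          by (auto simp: eq dest: agree_trans agree_sym)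
      next
        case 1
        then show ?thesis
          using st D1.extensionality[OF 1(2) st(4,5,6) ag1] ag0
          by (auto simp: eq dest: agree_trans agree_sym)
      qed
    }
  qed
qed

section \<open>Embedded formulas keep their semantics\<close>

text \<open>States, atoms and the evaluation of original programs are inherited by the lift, so
  every semantic clause unfolds alike on both sides. Together with its counterpart for the closure,
  this transfers validity.\<close>

lemma sem_havoc_emb: "sem (havoc_lift D) (havoc_emb F) = sem D F"
  by (induction F) simp_all

lemma sem_reg_emb: "sem (regular_closure D) (reg_emb F) = sem D F"
  by (induction F) simp_all

section \<open>Coincidence properties\<close>

context dynamic_theory
begin

text \<open>This is interpolation with a singleton set. It supplies the witnesses for quantifiers
  and for havoc programs.\<close>

lemma change_variable:
  assumes "v \<in> vars D" "\<mu> \<in> states D" "\<nu> \<in> states D"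
  obtains \<omega> where "\<omega> \<in> states D" "val D \<omega> v = val D \<mu> v" "agree D (vars D - {v}) \<omega> \<nu>"
  using interpolation[of \<mu> \<nu> "{v}"] assms by (auto simp: agree_def)

text \<open>Both states stay fixed in the induction: states with equal values have the same
  v-variants and, by extensionality, the same successors. The quantifier and box cases therefore
  compare identical conditions on F.\<close>

lemma sem_extensional:
  assumes "F \<in> formulas D" "\<mu> \<in> states D" "\<nu> \<in> states D" "agree D (vars D) \<mu> \<nu>"
  shows "\<mu> \<in> sem D F \<longleftrightarrow> \<nu> \<in> sem D F"
  using assms
proof (induction F)
  case (Atom a)
  then have "agree D (fvA D a) \<mu> \<nu>" using fvA_vars[of a] by (auto elim: agree_mono)
  then show ?case using evalA_agree Atom by simp
next
  case (All v F)
  have "agree D (vars D - {v}) \<mu> \<nu>" using All.prems by (auto intro: agree_mono)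
  then have "agree D (vars D - {v}) \<omega> \<mu> \<longleftrightarrow> agree D (vars D - {v}) \<omega> \<nu>" for \<omega>
    by (blast intro: agree_trans agree_sym)
  then show ?case using All.prems by simp
next
  case (Box p F)
  then have "(\<mu>, \<omega>) \<in> evalP D p \<longleftrightarrow> (\<nu>, \<omega>) \<in> evalP D p" for \<omega>
    using extensionality[of p \<mu> \<nu> \<omega>] evalP_states[of p] by auto
  then show ?case using Box.prems by simp
qed auto

lemma fvF_vars: "F \<in> formulas D \<Longrightarrow> fvF D F \<subseteq> vars D"
  by (induction F) (use fvA_vars fvP_vars in auto)

lemma finite_fvF: "F \<in> formulas D \<Longrightarrow> finite (fvF D F)"
  by (induction F) (use fvA_finite fvP_finite in auto)

text \<open>This is what overapproximation of a test requires, where the two states agree only on a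
  set containing the free variables of the tested formula.\<close>

lemma sem_coincidence:
  assumes "first_order F" "F \<in> formulas D" "\<mu> \<in> states D" "\<nu> \<in> states D"
    "agree D (fvF D F) \<mu> \<nu>"
  shows "\<mu> \<in> sem D F \<longleftrightarrow> \<nu> \<in> sem D F"
  using assms
proof (induction F arbitrary: \<mu> \<nu>)
  case (Atom a)
  then show ?case using evalA_agree by simp
next
  case (Neg F)
  then show ?case by auto
next
  case (And F G)
  have "agree D (fvF D F) \<mu> \<nu>" "agree D (fvF D G) \<mu> \<nu>"
    using And.prems(5) by (auto intro: agree_mono)
  then show ?case using And.IH[of \<mu> \<nu>] And.prems by simp
next
  case (All v F)
  then have v: "v \<in> vars D" and F: "first_order F" "F \<in> formulas D" by auto
  \<comment> \<open>One direction is proved for an arbitrary pair of states, so that it can be used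
    again with the roles exchanged.\<close>
  have "\<nu> \<in> sem D (All v F)"
    if \<mu>: "\<mu> \<in> states D" and \<nu>: "\<nu> \<in> states D" and ag: "agree D (fvF D F - {v}) \<mu> \<nu>"
      and sem: "\<mu> \<in> sem D (All v F)" for \<mu> \<nu>
  proof -
    have "\<nu>' \<in> sem D F" if \<nu>': "\<nu>' \<in> states D" "agree D (vars D - {v}) \<nu>' \<nu>" for \<nu>'
    proof -
      \<comment> \<open>A v-variant of \<nu> is matched by the v-variant of \<mu> that takes the
        same value at v. The two then agree on all free variables of F, including v, and the
        induction hypothesis applies.\<close>
      obtain \<mu>' where \<mu>': "\<mu>' \<in> states D" "val D \<mu>' v = val D \<nu>' v" "agree D (vars D - {v}) \<mu>' \<mu>"
        using change_variable v \<nu>'(1) \<mu> by blast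
      have "\<mu>' \<in> sem D F" using sem \<mu>' by simp
      moreover have "agree D (fvF D F) \<mu>' \<nu>'"
        unfolding agree_def
      proof
        fix w assume w: "w \<in> fvF D F"
        show "val D \<mu>' w = val D \<nu>' w"
        proof (cases "w = v")
          case False
          then have "w \<in> vars D - {v}" "w \<in> fvF D F - {v}"
            using w fvF_vars[OF F(2)] by auto
          then show ?thesis using \<mu>'(3) \<nu>'(2) ag by (simp add: agree_def)
        qed (use \<mu>' in simp)
      qed
      ultimately show ?thesis using All.IH F \<mu>'(1) \<nu>'(1) by blast
    qed
    then show ?thesis using \<nu> by simp
  qed
  from this[of \<mu> \<nu>] this[of \<nu> \<mu>] show ?case
    using All.prems(3-5) by (auto simp del: sem.simps dest: agree_sym)
next
  case (Box p F)
  then show ?case by simp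
qed

section \<open>The havoc lift\<close>

lemma dynamic_theory_havoc_lift: "dynamic_theory (havoc_lift D)"
proof -
  let ?D = "havoc_lift D"
  show ?thesis
  proof
    fix p assume "p \<in> progs ?D"
    then consider (orig) q where "p = Orig q" "q \<in> progs D"
      | (havoc) v where "p = Havoc v" "v \<in> vars D"
      by auto
    note cs = this
    show "evalP ?D p \<subseteq> states ?D \<times> states ?D"
      by (cases rule: cs) (use evalP_states in auto)
    show "fvP ?D p \<subseteq> vars ?D"
      by (cases rule: cs) (use fvP_vars in auto)
    show "finite (fvP ?D p)"
      by (cases rule: cs) (use fvP_finite in auto)
    fix \<mu> \<nu> \<omega>
    assume \<mu>: "\<mu> \<in> states ?D" and \<nu>: "\<nu> \<in> states ?D" and \<omega>: "\<omega> \<in> states ?D"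
    {
      fix W
      assume fv: "fvP ?D p \<subseteq> W" and W: "W \<subseteq> vars ?D"
        and ag: "agree ?D W \<mu> \<nu>" and run: "(\<mu>, \<omega>) \<in> evalP ?D p"
      show "\<exists>\<omega>'\<in>states ?D. (\<nu>, \<omega>') \<in> evalP ?D p \<and> agree ?D W \<omega> \<omega>'"
      proof (cases rule: cs)
        case orig
        then show ?thesis using overapproximation[of q W \<mu> \<nu> \<omega>] fv W \<mu> \<nu> \<omega> ag run by simp
      next
        case havoc
        \<comment> \<open>W may contain v, since havoc programs have no free variables. The witness
          therefore copies the value of v from \<omega> and all other values from \<nu>; on the rest
          of W, \<omega> agrees with \<mu> and \<mu> with \<nu>.\<close>
        obtain \<omega>' where \<omega>': "\<omega>' \<in> states D" "val D \<omega>' v = val D \<omega> v"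
          "agree D (vars D - {v}) \<omega>' \<nu>"
          using change_variable[of v \<omega> \<nu>] havoc(2) \<omega> \<nu> by auto
        have "agree D W \<omega> \<omega>'"
          unfolding agree_def
        proof
          fix w assume "w \<in> W"
          then show "val D \<omega> w = val D \<omega>' w"
            using \<omega>' havoc ag run subsetD[OF W, of w] by (cases "w = v") (auto simp: agree_def)
        qed
        then show ?thesis using \<omega>' havoc \<nu> by (auto intro!: bexI[of _ \<omega>'] dest: agree_sym)
      qed
    next
      assume ag: "agree ?D (vars ?D) \<mu> \<nu>"
      show "(\<mu>, \<omega>) \<in> evalP ?D p \<longleftrightarrow> (\<nu>, \<omega>) \<in> evalP ?D p"
      proof (cases rule: cs)
        case orig
        then show ?thesis using extensionality[of q \<mu> \<nu> \<omega>] \<mu> \<nu> \<omega> ag by simp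
      next
        case havoc
        have "agree D (vars D - {v}) \<mu> \<nu>" using ag by (auto intro: agree_mono)
        then show ?thesis using havoc \<mu> \<nu> \<omega> by (auto dest: agree_trans agree_sym)
      qed
    }
  \<comment> \<open>The axioms that do not concern programs are inherited verbatim.\<close>
  qed (use univ_nonempty states_nonempty val_in_univ interpolation evalA_states fvA_vars
      fvA_finite evalA_agree in simp_all)
qed

section \<open>The regular closure\<close>

lemma iterate_states: "R \<subseteq> states D \<times> states D \<Longrightarrow> iterate D R n \<subseteq> states D \<times> states D"
  by (induction n) auto

lemma reg_evalP_states: "p \<in> reg_progs D \<Longrightarrow> reg_evalP D p \<subseteq> states D \<times> states D"
proof (induction rule: reg_progs.induct)
  case (5 \<alpha>)
  then show ?case using iterate_states by (simp add: UN_subset_iff)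
qed (use evalP_states in auto)

lemma reg_fvP_vars: "p \<in> reg_progs D \<Longrightarrow> reg_fvP D p \<subseteq> vars D"
  by (induction rule: reg_progs.induct) (simp_all add: fvP_vars fvF_vars)

lemma finite_reg_fvP: "p \<in> reg_progs D \<Longrightarrow> finite (reg_fvP D p)"
  by (induction rule: reg_progs.induct) (simp_all add: fvP_finite finite_fvF)

text \<open>Runs are matched step by step, the agreement on W being carried along. In the zeroth
  power \<nu> answers by staying put. The relation R is arbitrary, so that the induction hypothesis
  for the body of a loop can be plugged in.\<close>

lemma iterate_overapproximation:
  assumes R: "\<And>\<mu> \<nu> \<omega>. (\<mu>, \<omega>) \<in> R \<Longrightarrow> \<nu> \<in> states D \<Longrightarrow> agree D W \<mu> \<nu> \<Longrightarrow>
      \<exists>\<omega>'\<in>states D. (\<nu>, \<omega>') \<in> R \<and> agree D W \<omega> \<omega>'"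
    and W: "W \<subseteq> vars D" and run: "(\<mu>, \<omega>) \<in> iterate D R n"
    and \<nu>: "\<nu> \<in> states D" and ag: "agree D W \<mu> \<nu>"
  shows "\<exists>\<omega>'\<in>states D. (\<nu>, \<omega>') \<in> iterate D R n \<and> agree D W \<omega> \<omega>'"
  using run \<nu> ag
proof (induction n arbitrary: \<mu> \<nu>)
  case 0
  then have "agree D W \<mu> \<omega>" using W by (auto intro: agree_mono)
  then have "agree D W \<omega> \<nu>" using 0 by (blast intro: agree_trans agree_sym)
  then show ?case using 0 by (intro bexI[of _ \<nu>]) (auto simp: agree_refl)
next
  case (Suc n)
  from Suc.prems(1) obtain \<mu>' where \<mu>': "(\<mu>, \<mu>') \<in> R" "(\<mu>', \<omega>) \<in> iterate D R n" by auto
  obtain \<nu>' where "\<nu>' \<in> states D" "(\<nu>, \<nu>') \<in> R" "agree D W \<mu>' \<nu>'"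
    using R[OF \<mu>'(1) Suc.prems(2,3)] by auto
  then show ?case using Suc.IH[OF \<mu>'(2), of \<nu>'] by auto
qed

text \<open>One W serves the whole induction: it contains the free variables of all subprograms, so
  the state reached by the first part of a sequence agrees on W with its counterpart and can start
  the second part.\<close>

lemma reg_overapproximation:
  assumes "p \<in> reg_progs D" "reg_fvP D p \<subseteq> W" "W \<subseteq> vars D"
    "(\<mu>, \<omega>) \<in> reg_evalP D p" "\<nu> \<in> states D" "agree D W \<mu> \<nu>"
  shows "\<exists>\<omega>'\<in>states D. (\<nu>, \<omega>') \<in> reg_evalP D p \<and> agree D W \<omega> \<omega>'"
  using assms
proof (induction arbitrary: \<mu> \<nu> \<omega> rule: reg_progs.induct)
  case (1 p)
  then show ?case using overapproximation[of p W \<mu> \<nu> \<omega>] evalP_states[of p] by auto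
next
  case (2 \<alpha> \<beta>)
  from "2.prems"(3) obtain \<mu>'
    where \<mu>': "(\<mu>, \<mu>') \<in> reg_evalP D \<alpha>" "(\<mu>', \<omega>) \<in> reg_evalP D \<beta>" by auto
  obtain \<nu>' where \<nu>': "\<nu>' \<in> states D" "(\<nu>, \<nu>') \<in> reg_evalP D \<alpha>" "agree D W \<mu>' \<nu>'"
    using "2.IH"(1)[OF _ _ \<mu>'(1), of \<nu>] "2.prems" by auto
  then obtain \<omega>' where "\<omega>' \<in> states D" "(\<nu>', \<omega>') \<in> reg_evalP D \<beta>" "agree D W \<omega> \<omega>'"
    using "2.IH"(2)[OF _ _ \<mu>'(2), of \<nu>'] "2.prems" by auto
  then show ?case using \<nu>' by auto
next
  case (3 \<alpha> \<beta>)
  then have fv: "reg_fvP D \<alpha> \<subseteq> W" "reg_fvP D \<beta> \<subseteq> W" by auto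
  from "3.prems"(3) consider "(\<mu>, \<omega>) \<in> reg_evalP D \<alpha>" | "(\<mu>, \<omega>) \<in> reg_evalP D \<beta>" by auto
  then show ?case
  proof cases
    case 1
    then show ?thesis using "3.IH"(1)[OF fv(1) "3.prems"(2) 1 "3.prems"(4,5)] by auto
  next
    case 2
    then show ?thesis using "3.IH"(2)[OF fv(2) "3.prems"(2) 2 "3.prems"(4,5)] by auto
  qed
next
  case (4 \<phi>)
  then have "\<mu> \<in> states D" "\<mu> \<in> sem D \<phi>" "agree D (vars D) \<mu> \<omega>" by auto
  \<comment> \<open>The answer to a test is \<nu> itself: the tested formula transfers from \<mu> by
    coincidence, and \<omega> has the values of \<mu>.\<close>
  moreover have "agree D (fvF D \<phi>) \<mu> \<nu>" using "4.prems" by (auto intro: agree_mono)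
  ultimately have "\<nu> \<in> sem D \<phi>" using sem_coincidence 4 by blast
  moreover have "agree D W \<omega> \<nu>"
    using \<open>agree D (vars D) \<mu> \<omega>\<close> "4.prems"(2,5) by (blast intro: agree_trans agree_sym agree_mono)
  ultimately show ?case using "4.prems"(4)
    by (intro bexI[of _ \<nu>]) (auto simp: agree_refl)
next
  case (5 \<alpha>)
  from "5.prems"(3) obtain n where "(\<mu>, \<omega>) \<in> iterate D (reg_evalP D \<alpha>) n" by auto
  then have "\<exists>\<omega>'\<in>states D. (\<nu>, \<omega>') \<in> iterate D (reg_evalP D \<alpha>) n \<and> agree D W \<omega> \<omega>'"
    using "5.prems" by (intro iterate_overapproximation "5.IH") auto
  then show ?case by auto
qed

text \<open>A case distinction suffices: with at least one step, the first step absorbs the change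
  of starting state, and the remaining run is kept.\<close>

lemma iterate_extensional:
  assumes R: "\<And>\<mu> \<nu> \<omega>. (\<mu>, \<omega>) \<in> R \<Longrightarrow> \<nu> \<in> states D \<Longrightarrow> agree D (vars D) \<mu> \<nu> \<Longrightarrow> (\<nu>, \<omega>) \<in> R"
    and "(\<mu>, \<omega>) \<in> iterate D R n" "\<nu> \<in> states D" "agree D (vars D) \<mu> \<nu>"
  shows "(\<nu>, \<omega>) \<in> iterate D R n"
  using assms(2-) by (cases n) (auto intro: R dest: agree_trans agree_sym)

text \<open>An implication is enough, because agreement is symmetric. Tests rest on
  \<open>sem_extensional\<close>; in a sequence only the first program sees the changed
  state.\<close>

lemma reg_extensional:
  assumes "p \<in> reg_progs D" "(\<mu>, \<omega>) \<in> reg_evalP D p" "\<nu> \<in> states D" "agree D (vars D) \<mu> \<nu>"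
  shows "(\<nu>, \<omega>) \<in> reg_evalP D p"
  using assms
proof (induction arbitrary: \<mu> \<nu> \<omega> rule: reg_progs.induct)
  case (1 p)
  then show ?case using extensionality[of p \<mu> \<nu> \<omega>] evalP_states[of p] by auto
next
  case (4 \<phi>)
  then show ?case using sem_extensional[of \<phi> \<mu> \<nu>] by (auto dest: agree_trans agree_sym)
next
  case (5 \<alpha>)
  from "5.prems"(1) obtain n where "(\<mu>, \<omega>) \<in> iterate D (reg_evalP D \<alpha>) n" by auto
  then have "(\<nu>, \<omega>) \<in> iterate D (reg_evalP D \<alpha>) n"
    using "5.prems"(2,3) by (rule iterate_extensional[rotated]) (rule "5.IH")
  then show ?case by auto
qed auto

lemma dynamic_theory_regular_closure: "dynamic_theory (regular_closure D)"
proof (unfold_locales, goal_cases)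
  \<comment> \<open>Goals 12 and 13 are overapproximation and extensionality.\<close>
  case (12 p W \<mu> \<nu> \<omega>)
  then show ?case using reg_overapproximation by simp
next
  case (13 p \<mu> \<nu> \<omega>)
  then show ?case using reg_extensional[of p \<mu> \<omega> \<nu>] reg_extensional[of p \<nu> \<omega> \<mu>] agree_sym[of D _ \<mu> \<nu>] by auto
qed (use univ_nonempty states_nonempty val_in_univ interpolation evalA_states fvA_vars fvA_finite
    evalA_agree reg_evalP_states reg_fvP_vars finite_reg_fvP in simp_all)

end

section \<open>Validity of the axioms\<close>

lemma valid_Iff:
  assumes "sem D F = sem D G"
  shows "valid D (Iff F G)"
  using assms by (auto simp: valid_def)

text \<open>The inner box demands that the intermediate state lie in the state set; this is where
  the evaluation of \<alpha> being a relation on states enters.\<close>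

lemma valid_Box_Seq:
  assumes "dynamic_theory D" "\<alpha> \<in> reg_progs D"
  shows "valid (regular_closure D) (Iff (Box (Seq \<alpha> \<beta>) \<chi>) (Box \<alpha> (Box \<beta> \<chi>)))"
  using dynamic_theory.reg_evalP_states[OF assms] by (intro valid_Iff) auto

lemma valid_Box_Choice:
  "valid (regular_closure D) (Iff (Box (Choice \<alpha> \<beta>) \<chi>) (And (Box \<alpha> \<chi>) (Box \<beta> \<chi>)))"
  by (intro valid_Iff) auto

text \<open>The havoc relation and the quantifier range over the same variants of a state, up to the
  order of arguments of \<open>agree\<close>.\<close>

lemma valid_Box_Havoc:
  "valid (regular_closure (havoc_lift D)) (Iff (Box (Base (Havoc v)) \<phi>) (All v \<phi>))"
  by (intro valid_Iff) (auto simp: agree_commute)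

text \<open>A successful test leads to every state with the same values, and \<psi> cannot tell
  these apart. The tested formula belongs to the original theory, so it is embedded on the
  right-hand side.\<close>

lemma valid_Box_Test:
  assumes "dynamic_theory D" "\<phi> \<in> formulas D" "\<psi> \<in> formulas (regular_closure D)"
  shows "valid (regular_closure D) (Iff (Box (Test \<phi>) \<psi>) (Imp (reg_emb \<phi>) \<psi>))"
proof (rule valid_Iff)
  interpret E: dynamic_theory "regular_closure D"
    using assms(1) by (rule dynamic_theory.dynamic_theory_regular_closure)
  have "\<mu> \<in> sem (regular_closure D) \<psi> \<longleftrightarrow> \<nu> \<in> sem (regular_closure D) \<psi>"
    if "\<mu> \<in> states D" "\<nu> \<in> states D" "agree D (vars D) \<mu> \<nu>" for \<mu> \<nu>
    using E.sem_extensional[OF assms(3)] that by simp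
  \<comment> \<open>From left to right, instantiate with \<mu> itself; the converse is
    extensionality of \<psi>.\<close>
  then have "(\<forall>\<nu>\<in>states D. agree D (vars D) \<mu> \<nu> \<longrightarrow> \<nu> \<in> sem (regular_closure D) \<psi>) \<longleftrightarrow>
      \<mu> \<in> sem (regular_closure D) \<psi>" if "\<mu> \<in> states D" for \<mu>
    using that by (meson agree_refl)
  then have "\<mu> \<in> sem (regular_closure D) (Box (Test \<phi>) \<psi>) \<longleftrightarrow>
      \<mu> \<in> sem (regular_closure D) (Imp (reg_emb \<phi>) \<psi>)" for \<mu>
    by (cases "\<mu> \<in> states D"; cases "\<mu> \<in> sem D \<phi>") (simp_all add: sem_reg_emb Ball_def imp_conjL)
  then show "sem (regular_closure D) (Box (Test \<phi>) \<psi>) =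
      sem (regular_closure D) (Imp (reg_emb \<phi>) \<psi>)"
    by blast
qed

text \<open>An iteration is either the zeroth power or one step followed by an iteration. The zeroth
  power contributes exactly \<chi>, again by extensionality.\<close>

lemma sem_Box_Star_unfold:
  assumes "dynamic_theory D" "\<alpha> \<in> reg_progs D" "\<chi> \<in> formulas (regular_closure D)"
  shows "sem (regular_closure D) (Box (Star \<alpha>) \<chi>) =
    sem (regular_closure D) (And \<chi> (Box \<alpha> (Box (Star \<alpha>) \<chi>)))"
proof -
  let ?E = "regular_closure D"
  let ?R = "reg_evalP D \<alpha>"
  interpret E: dynamic_theory ?E
    using assms(1) by (rule dynamic_theory.dynamic_theory_regular_closure)
  have states: "?R \<subseteq> states D \<times> states D"
    using assms(1,2) by (rule dynamic_theory.reg_evalP_states)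
  show ?thesis
  proof (intro equalityI subsetI)
    fix \<mu> assume \<mu>: "\<mu> \<in> sem ?E (Box (Star \<alpha>) \<chi>)"
    then have "(\<mu>, \<mu>) \<in> iterate D ?R 0" by (simp add: agree_refl)
    then have "(\<mu>, \<mu>) \<in> reg_evalP D (Star \<alpha>)" unfolding reg_evalP.simps by blast
    then have "\<mu> \<in> sem ?E \<chi>" using \<mu> by simp
    moreover have "\<omega> \<in> sem ?E \<chi>" if "(\<mu>, \<nu>) \<in> ?R" "(\<nu>, \<omega>) \<in> iterate D ?R n" for \<nu> \<omega> n
    proof -
      have "(\<mu>, \<omega>) \<in> iterate D ?R (Suc n)" using that by auto
      then have "(\<mu>, \<omega>) \<in> reg_evalP D (Star \<alpha>)" unfolding reg_evalP.simps by blast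
      then show ?thesis using \<mu> by simp
    qed
    ultimately show "\<mu> \<in> sem ?E (And \<chi> (Box \<alpha> (Box (Star \<alpha>) \<chi>)))"
      using \<mu> states by auto
  next
    fix \<mu> assume \<mu>: "\<mu> \<in> sem ?E (And \<chi> (Box \<alpha> (Box (Star \<alpha>) \<chi>)))"
    have "\<omega> \<in> sem ?E \<chi>" if "(\<mu>, \<omega>) \<in> iterate D ?R n" for n \<omega>
    proof (cases n)
      case 0
      then show ?thesis using \<mu> that E.sem_extensional[OF assms(3), of \<mu> \<omega>] by simp
    next
      case (Suc m)
      then show ?thesis using \<mu> that by auto
    qed
    then show "\<mu> \<in> sem ?E (Box (Star \<alpha>) \<chi>)" using \<mu> by auto
  qed
qed

text \<open>Induction on the number of steps carries two facts along a run: \<chi> holds at the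
  current state, and the boxed induction step still holds there.\<close>

lemma valid_Box_Star_induct:
  assumes "dynamic_theory D" "\<alpha> \<in> reg_progs D" "\<chi> \<in> formulas (regular_closure D)"
  shows "valid (regular_closure D)
    (Imp (Box (Star \<alpha>) (Imp \<chi> (Box \<alpha> \<chi>))) (Imp \<chi> (Box (Star \<alpha>) \<chi>)))"
proof -
  let ?E = "regular_closure D"
  let ?step = "Imp \<chi> (Box \<alpha> \<chi>)"
  interpret E: dynamic_theory ?E
    using assms(1) by (rule dynamic_theory.dynamic_theory_regular_closure)
  have "?step \<in> formulas ?E" using assms(2,3) by simp
  note unfold = sem_Box_Star_unfold[OF assms(1,2) this]
  have "\<nu> \<in> sem ?E \<chi>"
    if "(\<mu>, \<nu>) \<in> iterate D (reg_evalP D \<alpha>) n" "\<mu> \<in> sem ?E \<chi>" "\<mu> \<in> sem ?E (Box (Star \<alpha>) ?step)"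
    for \<mu> \<nu> n
    using that
  \<comment> \<open>The start of the run varies and its end is fixed, because \<open>iterate\<close>
    splits off the first step.\<close>
  proof (induction n arbitrary: \<mu>)
    case 0
    then show ?case using E.sem_extensional[OF assms(3), of \<mu> \<nu>] by simp
  next
    case (Suc n)
    then obtain \<mu>' where \<mu>': "(\<mu>, \<mu>') \<in> reg_evalP D \<alpha>" "(\<mu>', \<nu>) \<in> iterate D (reg_evalP D \<alpha>) n"
      by auto
    \<comment> \<open>Unfolding the loop once yields the implication at \<mu>, which moves \<chi> to
      \<mu>', and the boxed implication after one step, which restores the second premise at
      \<mu>'.\<close>
    have "\<mu> \<in> sem ?E ?step" and loop: "\<mu> \<in> sem ?E (Box \<alpha> (Box (Star \<alpha>) ?step))"
      using subsetD[OF equalityD1[OF unfold] Suc.prems(3)]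
      by (simp_all only: sem.simps(3) Int_iff)
    then have "\<mu>' \<in> sem ?E \<chi>"
      using \<mu>'(1) Suc.prems(2) by auto
    moreover have "\<mu>' \<in> sem ?E (Box (Star \<alpha>) ?step)"
      using loop \<mu>'(1) unfolding sem.simps(5)[of _ \<alpha>] regular_closure_simps by blast
    ultimately show ?case using Suc.IH \<mu>'(2) by blast
  qed
  then show ?thesis by (simp add: valid_def) blast
qed


theorem mainTheorem13:
  fixes D0 :: "('v0, 'a0, 'p0, 'u, 's0) dyn_theory"
    and D1 :: "('v1, 'a1, 'p1, 'u, 's1) dyn_theory"
    and H :: "('c, 'v0, 'v1, 's0, 's1) het_atoms"
  assumes "dynamic_theory D0" and "dynamic_theory D1" and "heterogeneous_atoms D0 D1 H"
  shows "dynamic_theory (full_het D0 D1 H) \<and>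
    (\<forall>\<phi> \<in> formulas (havoc_lift (simple_het D0 D1 H)). \<forall>\<psi> \<in> formulas (full_het D0 D1 H).
       first_order \<phi> \<longrightarrow>
       valid (full_het D0 D1 H) (Iff (Box (Test \<phi>) \<psi>) (Imp (reg_emb \<phi>) \<psi>))) \<and>
    (\<forall>\<alpha> \<in> progs (full_het D0 D1 H). \<forall>\<beta> \<in> progs (full_het D0 D1 H).
       \<forall>\<chi> \<in> formulas (full_het D0 D1 H).
       valid (full_het D0 D1 H) (Iff (Box (Seq \<alpha> \<beta>) \<chi>) (Box \<alpha> (Box \<beta> \<chi>)))) \<and>
    (\<forall>\<alpha> \<in> progs (full_het D0 D1 H). \<forall>\<chi> \<in> formulas (full_het D0 D1 H).
       valid (full_het D0 D1 H) (Iff (Box (Star \<alpha>) \<chi>) (And \<chi> (Box \<alpha> (Box (Star \<alpha>) \<chi>))))) \<and>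
    (\<forall>\<alpha> \<in> progs (full_het D0 D1 H). \<forall>\<beta> \<in> progs (full_het D0 D1 H).
       \<forall>\<chi> \<in> formulas (full_het D0 D1 H).
       valid (full_het D0 D1 H) (Iff (Box (Choice \<alpha> \<beta>) \<chi>) (And (Box \<alpha> \<chi>) (Box \<beta> \<chi>)))) \<and>
    (\<forall>\<alpha> \<in> progs (full_het D0 D1 H). \<forall>\<chi> \<in> formulas (full_het D0 D1 H).
       valid (full_het D0 D1 H)
         (Imp (Box (Star \<alpha>) (Imp \<chi> (Box \<alpha> \<chi>))) (Imp \<chi> (Box (Star \<alpha>) \<chi>)))) \<and>
    (\<forall>v \<in> vars (full_het D0 D1 H). \<forall>\<phi> \<in> formulas (full_het D0 D1 H).
       valid (full_het D0 D1 H) (Iff (Box (Base (Havoc v)) \<phi>) (All v \<phi>))) \<and>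
    (\<forall>\<phi> \<in> formulas (simple_het D0 D1 H). valid (simple_het D0 D1 H) \<phi> \<longrightarrow>
       valid (havoc_lift (simple_het D0 D1 H)) (havoc_emb \<phi>)) \<and>
    (\<forall>\<phi> \<in> formulas (havoc_lift (simple_het D0 D1 H)).
       valid (havoc_lift (simple_het D0 D1 H)) \<phi> \<longrightarrow>
       valid (full_het D0 D1 H) (reg_emb \<phi>))"
proof -
  let ?S = "simple_het D0 D1 H"
  let ?L = "havoc_lift ?S"
  have S: "dynamic_theory ?S"
    using assms by (rule dynamic_theory_simple_het)
  then have L: "dynamic_theory ?L"
    by (rule dynamic_theory.dynamic_theory_havoc_lift)
  show ?thesis
    unfolding full_het_def
  \<comment> \<open>Goal 1 is the dynamic theory property, goals 2 to 6 are the axioms for regular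
    programs, goal 7 is the havoc axiom, and goals 8 and 9 are the two transfers of
    validity.\<close>
  proof (intro conjI ballI impI, goal_cases)
    case 1
    show ?case using L by (rule dynamic_theory.dynamic_theory_regular_closure)
  next
    case (2 \<phi> \<psi>)
    then show ?case using valid_Box_Test[OF L] by blast
  next
    case (3 \<alpha> \<beta> \<chi>)
    then show ?case using valid_Box_Seq[OF L] by simp
  next
    case (4 \<alpha> \<chi>)
    then show ?case by (intro valid_Iff sem_Box_Star_unfold[OF L]) simp_all
  next
    case (5 \<alpha> \<beta> \<chi>)
    show ?case by (rule valid_Box_Choice)
  next
    case (6 \<alpha> \<chi>)
    then show ?case using valid_Box_Star_induct[OF L] by simp
  next
    case (7 v \<phi>)
    show ?case by (rule valid_Box_Havoc)
  next
    case (8 \<phi>)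
    then show ?case by (simp add: valid_def sem_havoc_emb)
  next
    case (9 \<phi>)
    then show ?case by (simp add: valid_def sem_reg_emb)
  qed
qed

end
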